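(* Let $(W,S)$ be a Coxeter system with $S$ finite. Let $\mathscr{T}$ be the cone type partition of $W$ and let $\mathscr{D}$ be the partition of $W$ according to left descent sets ($x,y$ are in the same part of $\mathscr{D}$ if and only if $D_L(x)=D_L(y)$). Then $\mathscr{T}=\widehat{\mathscr{D}}$, the regular completion of $\mathscr{D}$.
   Context: $\ell$ is the length function and $D_L(w)=\{s\in S\mid \ell(sw)=\ell(w)-1\}$. A partition of $W$ is a set of nonempty pairwise disjoint subsets (parts) with union $W$; $\mathscr{P}\leq\mathscr{P}'$ means that $\mathscr{P}'$ refines $\mathscr{P}$ (each part of $\mathscr{P}'$ is contained in a part of $\mathscr{P}$). A partition $\mathscr{P}$ is regular if: (1) $D_L$ is constant on each part $P$ (common value $D_L(P)$); and (2) if $P\in\mathscr{P}$ and $s\in S\setminus D_L(P)$ then $sP\subseteq P'$ for some part $P'\in\mathscr{P}$. The set $\mathscr{P}_{\mathrm{reg}}(W)$ of regular partitions, ordered by $\leq$, is a complete lattice. The regular completion of a partition $\mathscr{P}$ of $W$ is the meet, taken in $(\mathscr{P}_{\mathrm{reg}}(W),\leq)$, $$\widehat{\mathscr{P}}=\bigwedge\{\mathscr{R}\in\mathscr{P}_{\mathrm{reg}}(W)\mid \mathscr{P}\leq\mathscr{R}\}.$$ The cone type of $x\in W$ is $T(x)=\{y\in W\mid \ell(xy)=\ell(x)+\ell(y)\}$. In the cone type partition $\mathscr{T}$, elements $x,y$ lie in the same part iff $T(x^{-1})=T(y^{-1})$. *)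

theory Defs
  imports "HOL-Algebra.Algebra" "HOL-Library.Disjoint_Sets"
begin

section \<open>Group presentations\<close>

text \<open>
  A word over \<open>S\<close> is a list of letters \<open>(s, b)\<close>, where \<open>(s, True)\<close> stands for \<open>s\<close> and
  \<open>(s, False)\<close> for its formal inverse.
\<close>

definition group_words :: "'a set \<Rightarrow> ('a \<times> bool) list set" where
  "group_words S = lists (S \<times> UNIV)"

definition word_value :: "('a, 'b) monoid_scheme \<Rightarrow> ('a \<times> bool) list \<Rightarrow> 'a" where
  "word_value G w =
     foldr (\<lambda>(s, b) g. (if b then s else inv\<^bsub>G\<^esub> s) \<otimes>\<^bsub>G\<^esub> g) w \<one>\<^bsub>G\<^esub>"

text \<open>
  The classes of the following congruence on words are the elements of the abstract group with
  generators \<open>S\<close> and relators \<open>R\<close>.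
\<close>

inductive presentation_eq ::
  "'a set \<Rightarrow> ('a \<times> bool) list set \<Rightarrow> ('a \<times> bool) list \<Rightarrow> ('a \<times> bool) list \<Rightarrow> bool"
  for S R where
    refl: "w \<in> group_words S \<Longrightarrow> presentation_eq S R w w"
  | sym: "presentation_eq S R v w \<Longrightarrow> presentation_eq S R w v"
  | trans: "presentation_eq S R u v \<Longrightarrow> presentation_eq S R v w \<Longrightarrow> presentation_eq S R u w"
  | cancel: "u \<in> group_words S \<Longrightarrow> v \<in> group_words S \<Longrightarrow> s \<in> S \<Longrightarrow>
      presentation_eq S R (u @ [(s, b), (s, \<not> b)] @ v) (u @ v)"
  | relator: "u \<in> group_words S \<Longrightarrow> v \<in> group_words S \<Longrightarrow> r \<in> R \<Longrightarrow>
      presentation_eq S R (u @ r @ v) (u @ v)"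

definition presented_group ::
  "('a, 'b) monoid_scheme \<Rightarrow> 'a set \<Rightarrow> ('a \<times> bool) list set \<Rightarrow> bool" where
  "presented_group G S R \<longleftrightarrow>
     group G \<and> S \<subseteq> carrier G \<and> R \<subseteq> group_words S \<and> generate G S = carrier G \<and>
     (\<forall>v \<in> group_words S. \<forall>w \<in> group_words S.
        word_value G v = word_value G w \<longleftrightarrow> presentation_eq S R v w)"

section \<open>Coxeter systems\<close>

text \<open>The value \<open>0\<close> encodes \<open>m s t = \<infinity>\<close>; the corresponding relator is then the empty word.\<close>

definition coxeter_matrix :: "'a set \<Rightarrow> ('a \<Rightarrow> 'a \<Rightarrow> nat) \<Rightarrow> bool" where
  "coxeter_matrix S m \<longleftrightarrow>
     (\<forall>s \<in> S. m s s = 1) \<and>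
     (\<forall>s \<in> S. \<forall>t \<in> S. m s t = m t s) \<and>
     (\<forall>s \<in> S. \<forall>t \<in> S. s \<noteq> t \<longrightarrow> m s t = 0 \<or> 2 \<le> m s t)"

definition coxeter_relators :: "'a set \<Rightarrow> ('a \<Rightarrow> 'a \<Rightarrow> nat) \<Rightarrow> ('a \<times> bool) list set" where
  "coxeter_relators S m =
     {concat (replicate (m s t) [(s, True), (t, True)]) | s t. s \<in> S \<and> t \<in> S}"

definition coxeter_system :: "('a, 'b) monoid_scheme \<Rightarrow> 'a set \<Rightarrow> bool" where
  "coxeter_system W S \<longleftrightarrow>
     (\<exists>m. coxeter_matrix S m \<and> presented_group W S (coxeter_relators S m))"

definition cox_length :: "('a, 'b) monoid_scheme \<Rightarrow> 'a set \<Rightarrow> 'a \<Rightarrow> nat" where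
  "cox_length W S w =
     (LEAST n. \<exists>xs \<in> lists S. length xs = n \<and> foldr (\<otimes>\<^bsub>W\<^esub>) xs \<one>\<^bsub>W\<^esub> = w)"

definition left_descents :: "('a, 'b) monoid_scheme \<Rightarrow> 'a set \<Rightarrow> 'a \<Rightarrow> 'a set" where
  "left_descents W S w =
     {s \<in> S. int (cox_length W S (s \<otimes>\<^bsub>W\<^esub> w)) = int (cox_length W S w) - 1}"

definition cone_type :: "('a, 'b) monoid_scheme \<Rightarrow> 'a set \<Rightarrow> 'a \<Rightarrow> 'a set" where
  "cone_type W S x =
     {y \<in> carrier W. cox_length W S (x \<otimes>\<^bsub>W\<^esub> y) = cox_length W S x + cox_length W S y}"

section \<open>Regular partitions\<close>

definition descent_partition :: "('a, 'b) monoid_scheme \<Rightarrow> 'a set \<Rightarrow> 'a set set" where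
  "descent_partition W S =
     carrier W // {(x, y) \<in> carrier W \<times> carrier W. left_descents W S x = left_descents W S y}"

definition cone_type_partition :: "('a, 'b) monoid_scheme \<Rightarrow> 'a set \<Rightarrow> 'a set set" where
  "cone_type_partition W S =
     carrier W // {(x, y) \<in> carrier W \<times> carrier W.
       cone_type W S (inv\<^bsub>W\<^esub> x) = cone_type W S (inv\<^bsub>W\<^esub> y)}"

text \<open>As \<open>P\<close> is nonempty, the set \<open>D\<close> below is the common left descent set of its elements.\<close>

definition regular_partition :: "('a, 'b) monoid_scheme \<Rightarrow> 'a set \<Rightarrow> 'a set set \<Rightarrow> bool" where
  "regular_partition W S \<P> \<longleftrightarrow>
     partition_on (carrier W) \<P> \<and>
     (\<forall>P \<in> \<P>. \<exists>D. (\<forall>x \<in> P. left_descents W S x = D) \<and>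
        (\<forall>s \<in> S - D. \<exists>P' \<in> \<P>. s <#\<^bsub>W\<^esub> P \<subseteq> P'))"

text \<open>Finer partitions are larger in the order.\<close>

definition partition_le :: "'a set \<Rightarrow> 'a set set \<Rightarrow> 'a set set \<Rightarrow> bool" where
  "partition_le A \<P> \<P>' \<longleftrightarrow> refines A \<P>' \<P>"

definition regular_partition_order :: "('a, 'b) monoid_scheme \<Rightarrow> 'a set \<Rightarrow> 'a set set gorder" where
  "regular_partition_order W S =
     \<lparr>carrier = {\<P>. regular_partition W S \<P>}, eq = (=), le = partition_le (carrier W)\<rparr>"

definition regular_completion ::
  "('a, 'b) monoid_scheme \<Rightarrow> 'a set \<Rightarrow> 'a set set \<Rightarrow> 'a set set" where
  "regular_completion W S \<P> =
     \<Sqinter>\<^bsub>regular_partition_order W S\<^esub>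
       {\<R> \<in> carrier (regular_partition_order W S). partition_le (carrier W) \<P> \<R>}"

end

theory Submission
  imports Defs
begin

text \<open>
  Sending \<open>S\<close> to \<open>-1\<close> respects the Coxeter relations, so \<open>\<ell>(sx) = \<ell>(x) \<plusminus> 1\<close>. Hence \<open>s \<notin> D\<^sub>L(x)\<close>
  iff \<open>s \<in> T(x\<inverse>)\<close>, and in that case \<open>z \<in> T((sx)\<inverse>)\<close> iff \<open>sz \<in> T(x\<inverse>)\<close> and \<open>\<ell>(sz) = \<ell>(z) + 1\<close>.
  So \<open>T(x\<inverse>)\<close> determines both \<open>D\<^sub>L(x)\<close> and \<open>T((sx)\<inverse>)\<close>, i.e. the cone type partition is regular
  and refines \<open>\<D>\<close>. Conversely, in any regular partition the part of \<open>x\<close> determines \<open>D\<^sub>L(x)\<close> and,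
  for \<open>s \<notin> D\<^sub>L(x)\<close>, the part of \<open>sx\<close>, hence whether \<open>sz \<in> T(x\<inverse>)\<close>, by induction on \<open>\<ell>(z)\<close>;
  so the cone type partition is the least regular partition of all.
\<close>

section \<open>Words in the generators and the parity of their lengths\<close>

locale coxeter = group W for W :: "('a, 'b) monoid_scheme" (structure) +
  fixes S :: "'a set"
  assumes coxeter_system: "coxeter_system W S"
begin

abbreviation len :: "'a \<Rightarrow> nat" where
  "len \<equiv> cox_length W S"

abbreviation word_prod :: "'a list \<Rightarrow> 'a" where
  "word_prod xs \<equiv> foldr (\<otimes>) xs \<one>"

lemma gen_closed [simp]: "s \<in> S \<Longrightarrow> s \<in> carrier W"
  using coxeter_system by (auto simp: coxeter_system_def presented_group_def)

lemma word_prod_closed [simp]: "xs \<in> lists S \<Longrightarrow> word_prod xs \<in> carrier W"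
  by (induction xs) auto

lemma word_prod_append:
  "xs \<in> lists S \<Longrightarrow> ys \<in> lists S \<Longrightarrow> word_prod (xs @ ys) = word_prod xs \<otimes> word_prod ys"
  by (induction xs) (auto simp: m_assoc)

text \<open>The relator of the pair \<open>(s, s)\<close> is the two-letter word \<open>s s\<close>,
  because the diagonal entry of the matrix is 1.\<close>

lemma gen_square: assumes "s \<in> S" shows "s \<otimes> s = \<one>"
proof -
  obtain m where m: "coxeter_matrix S m" "presented_group W S (coxeter_relators S m)"
    using coxeter_system by (auto simp: coxeter_system_def)
  have "concat (replicate (m s s) [(s, True), (s, True)]) \<in> coxeter_relators S m"
    using assms by (auto simp: coxeter_relators_def)
  moreover have "m s s = 1"
    using m(1) assms by (auto simp: coxeter_matrix_def)
  ultimately have "[(s, True), (s, True)] \<in> coxeter_relators S m"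
    by simp
  from presentation_eq.relator[OF _ _ this, of "[]" S "[]"]
  have "presentation_eq S (coxeter_relators S m) [(s, True), (s, True)] []"
    by (simp add: group_words_def)
  with m(2) assms have "word_value W [(s, True), (s, True)] = word_value W []"
    by (auto simp: presented_group_def group_words_def)
  then show ?thesis
    using assms by (simp add: word_value_def)
qed

lemma gen_inv: "s \<in> S \<Longrightarrow> inv s = s"
  by (intro inv_equality gen_square gen_closed)

lemma gen_cancel: "s \<in> S \<Longrightarrow> x \<in> carrier W \<Longrightarrow> s \<otimes> (s \<otimes> x) = x"
  by (simp add: m_assoc [symmetric] gen_square)

text \<open>Generators are involutions, so the inverses allowed by \<open>generate\<close> can be
  replaced by generators; positive words are the ones that \<open>cox_length\<close>
  measures.\<close>

lemma word_exists:
  assumes "x \<in> carrier W"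
  obtains xs where "xs \<in> lists S" "word_prod xs = x"
proof -
  have "x \<in> generate W S"
    using coxeter_system assms by (auto simp: coxeter_system_def presented_group_def)
  then have "\<exists>xs \<in> lists S. word_prod xs = x"
  proof induction
    case one
    show ?case by (intro bexI[of _ "[]"]) auto
  next
    case (incl h)
    then show ?case by (intro bexI[of _ "[h]"]) auto
  next
    case (inv h)
    then show ?case by (intro bexI[of _ "[h]"]) (auto simp: gen_inv)
  next
    case (eng h1 h2)
    then obtain xs ys where "xs \<in> lists S" "ys \<in> lists S" "word_prod xs = h1" "word_prod ys = h2"
      by blast
    then show ?case by (intro bexI[of _ "xs @ ys"]) (auto simp del: foldr_append simp: word_prod_append)
  qed
  then show thesis using that by blast
qed

text \<open>Free cancellation removes two letters, and a relator has length
  \<open>2 * m s t\<close>, which is 0 for the code of infinity. This is the sign character,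
  expressed on words.\<close>

lemma presentation_eq_parity:
  assumes "presentation_eq S (coxeter_relators S m) v w"
  shows "even (length v) \<longleftrightarrow> even (length w)"
  using assms
  by induction (auto simp: coxeter_relators_def length_concat sum_list_replicate)

lemma word_prod_parity:
  assumes "xs \<in> lists S" "ys \<in> lists S" "word_prod xs = word_prod ys"
  shows "even (length xs) \<longleftrightarrow> even (length ys)"
proof -
  let ?w = "map (\<lambda>s. (s, True))"
  obtain m where m: "presented_group W S (coxeter_relators S m)"
    using coxeter_system by (auto simp: coxeter_system_def)
  have val: "word_value W (?w zs) = word_prod zs" for zs
    by (induction zs) (auto simp: word_value_def)
  have "?w xs \<in> group_words S" "?w ys \<in> group_words S"
    using assms by (auto simp: group_words_def)
  \<comment> \<open>The presentation is used here from values to words: two words with the same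
    value are congruent.\<close>
  with m have "presentation_eq S (coxeter_relators S m) (?w xs) (?w ys)"
    using assms(3) unfolding presented_group_def by (metis val)
  from presentation_eq_parity[OF this] show ?thesis by simp
qed

section \<open>The length function\<close>

lemma len_le: "xs \<in> lists S \<Longrightarrow> len (word_prod xs) \<le> length xs"
  unfolding cox_length_def by (rule Least_le) blast

lemma reduced_word:
  assumes "x \<in> carrier W"
  obtains xs where "xs \<in> lists S" "length xs = len x" "word_prod xs = x"
proof -
  obtain ys where "ys \<in> lists S" "word_prod ys = x"
    using assms word_exists by blast
  then have "\<exists>n. \<exists>xs \<in> lists S. length xs = n \<and> word_prod xs = x"
    by blast
  from LeastI_ex[OF this] show thesis
    using that unfolding cox_length_def by blast
qed

lemma len_mult_le:
  assumes "x \<in> carrier W" "y \<in> carrier W"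
  shows "len (x \<otimes> y) \<le> len x + len y"
proof -
  obtain xs ys where w: "xs \<in> lists S" "length xs = len x" "word_prod xs = x"
      "ys \<in> lists S" "length ys = len y" "word_prod ys = y"
    using reduced_word assms by metis
  then have "len (word_prod (xs @ ys)) \<le> length (xs @ ys)"
    by (intro len_le) auto
  with w show ?thesis
    by (simp del: foldr_append add: word_prod_append)
qed

lemma len_one [simp]: "len \<one> = 0"
  using len_le[of "[]"] by simp

lemma len_0_imp_one: "x \<in> carrier W \<Longrightarrow> len x = 0 \<Longrightarrow> x = \<one>"
  by (erule reduced_word) simp

lemma word_prod_rev: "xs \<in> lists S \<Longrightarrow> word_prod (rev xs) = inv (word_prod xs)"
proof (induction xs)
  case (Cons s xs)
  then have s: "s \<in> S" and xs: "xs \<in> lists S" by auto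
  have "word_prod (rev (s # xs)) = word_prod (rev xs) \<otimes> word_prod [s]"
    using s xs word_prod_append[of "rev xs" "[s]"] by (simp add: in_lists_conv_set)
  with Cons.IH s xs show ?case
    by (simp add: inv_mult_group gen_inv)
qed simp

text \<open>A reduced word of \<open>x\<close> read backwards is a word for the inverse.\<close>

lemma len_inv_le: assumes "x \<in> carrier W" shows "len (inv x) \<le> len x"
proof -
  obtain xs where w: "xs \<in> lists S" "length xs = len x" "word_prod xs = x"
    using reduced_word assms by metis
  with len_le[of "rev xs"] show ?thesis
    by (simp add: word_prod_rev in_lists_conv_set)
qed

lemma len_inv [simp]: "x \<in> carrier W \<Longrightarrow> len (inv x) = len x"
  using len_inv_le[of x] len_inv_le[of "inv x"] by simp

lemma len_gen_le: "s \<in> S \<Longrightarrow> len s \<le> 1"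
  using len_le[of "[s]"] by simp

text \<open>Prefixing \<open>s\<close> to a reduced word of \<open>x\<close> gives a word for
  \<open>s \<otimes> x\<close> of length \<open>len x + 1\<close>, whose parity must agree with that
  of \<open>len (s \<otimes> x)\<close>.\<close>

lemma len_gen_mult_neq:
  assumes "s \<in> S" "x \<in> carrier W"
  shows "len (s \<otimes> x) \<noteq> len x"
proof
  assume eq: "len (s \<otimes> x) = len x"
  obtain xs where xs: "xs \<in> lists S" "length xs = len x" "word_prod xs = x"
    using reduced_word assms by metis
  obtain ys where ys: "ys \<in> lists S" "length ys = len (s \<otimes> x)" "word_prod ys = s \<otimes> x"
    using reduced_word assms by (metis gen_closed m_closed)
  have "even (length (s # xs)) \<longleftrightarrow> even (length ys)"
    using xs ys assms by (intro word_prod_parity) auto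
  with xs ys eq show False by simp
qed

lemma len_gen_mult:
  assumes "s \<in> S" "x \<in> carrier W"
  shows "len (s \<otimes> x) = len x + 1 \<or> len x = len (s \<otimes> x) + 1"
proof -
  have "len (s \<otimes> x) \<le> 1 + len x"
    using len_mult_le[of s x] len_gen_le assms by fastforce
  \<comment> \<open>The same bound applied to \<open>s \<otimes> x\<close> bounds
    \<open>len x\<close> from above, since the two factors \<open>s\<close> cancel.\<close>
  moreover have "len (s \<otimes> (s \<otimes> x)) \<le> 1 + len (s \<otimes> x)"
    using len_mult_le[of s "s \<otimes> x"] len_gen_le assms by fastforce
  ultimately show ?thesis
    using len_gen_mult_neq[OF assms] unfolding gen_cancel[OF assms] by arith
qed

lemma len_gen: "s \<in> S \<Longrightarrow> len s = 1"
  using len_gen_mult[of s "\<one>"] by simp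

section \<open>Descent sets and cone types\<close>

lemma not_left_descent_iff:
  assumes "s \<in> S" "x \<in> carrier W"
  shows "s \<notin> left_descents W S x \<longleftrightarrow> len (s \<otimes> x) = len x + 1"
  using len_gen_mult[OF assms] assms by (auto simp: left_descents_def)

text \<open>Inversion preserves length and exchanges \<open>s \<otimes> x\<close> with
  \<open>inv x \<otimes> s\<close>; as \<open>len s = 1\<close>, growth by one is additivity of
  lengths.\<close>

lemma not_left_descent_iff_cone:
  assumes "s \<in> S" "x \<in> carrier W"
  shows "s \<notin> left_descents W S x \<longleftrightarrow> s \<in> cone_type W S (inv x)"
proof -
  have "len (inv x \<otimes> s) = len (s \<otimes> x)"
    using assms by (metis gen_closed gen_inv inv_mult_group len_inv m_closed)
  then show ?thesis
    using assms by (simp add: not_left_descent_iff cone_type_def len_gen)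
qed

lemma left_descents_eq_cone:
  assumes "x \<in> carrier W"
  shows "left_descents W S x = S - cone_type W S (inv x)"
  using not_left_descent_iff_cone[OF _ assms] by (auto simp: left_descents_def)

text \<open>Both sides concern the length of \<open>inv x \<otimes> (s \<otimes> z)\<close>.
  Subadditivity bounds it by \<open>len x + len (s \<otimes> z)\<close>, so it can reach
  \<open>len x + 1 + len z\<close> only if \<open>s\<close> lengthens \<open>z\<close>.\<close>

lemma cone_type_gen_mult:
  assumes "s \<in> S" "x \<in> carrier W" "s \<notin> left_descents W S x"
  shows "z \<in> cone_type W S (inv (s \<otimes> x)) \<longleftrightarrow>
    z \<in> carrier W \<and> s \<otimes> z \<in> cone_type W S (inv x) \<and> len (s \<otimes> z) = len z + 1"
proof (cases "z \<in> carrier W")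
  case True
  have len_inv_sx: "len (inv (s \<otimes> x)) = len x + 1"
    using assms by (simp add: not_left_descent_iff)
  have assoc: "inv (s \<otimes> x) \<otimes> z = inv x \<otimes> (s \<otimes> z)"
    using assms True by (simp add: inv_mult_group gen_inv m_assoc)
  have "len (inv x \<otimes> (s \<otimes> z)) \<le> len x + len (s \<otimes> z)"
    using len_mult_le[of "inv x" "s \<otimes> z"] assms True by simp
  then have "len (inv (s \<otimes> x) \<otimes> z) = len (inv (s \<otimes> x)) + len z \<longleftrightarrow>
      len (inv x \<otimes> (s \<otimes> z)) = len (inv x) + len (s \<otimes> z) \<and> len (s \<otimes> z) = len z + 1"
    using len_gen_mult[OF assms(1) True]
    unfolding len_inv_sx assoc len_inv[OF assms(2)] by presburger
  then show ?thesis
    using assms True by (simp add: cone_type_def)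
qed (simp add: cone_type_def)

section \<open>Regularity of the cone type partition\<close>

lemma equiv_cone:
  "equiv (carrier W) {(x, y) \<in> carrier W \<times> carrier W.
       cone_type W S (inv x) = cone_type W S (inv y)}"
  by (rule equivI) (auto simp: refl_on_def sym_def trans_def)

lemma equiv_descent:
  "equiv (carrier W) {(x, y) \<in> carrier W \<times> carrier W. left_descents W S x = left_descents W S y}"
  by (rule equivI) (auto simp: refl_on_def sym_def trans_def)

lemma cone_part:
  assumes "P \<in> cone_type_partition W S" "x \<in> P"
  shows "x \<in> carrier W"
    and "P = {y \<in> carrier W. cone_type W S (inv y) = cone_type W S (inv x)}"
  using assms by (auto simp: cone_type_partition_def quotient_def)

lemma cone_partI:
  "x \<in> carrier W \<Longrightarrow>
   {y \<in> carrier W. cone_type W S (inv y) = cone_type W S (inv x)} \<in> cone_type_partition W S"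
  unfolding cone_type_partition_def quotient_def by (auto intro!: bexI[of _ x])

lemma partition_on_cone: "partition_on (carrier W) (cone_type_partition W S)"
  unfolding cone_type_partition_def using equiv_cone by (rule partition_on_quotient)

lemma regular_cone: "regular_partition W S (cone_type_partition W S)"
  unfolding regular_partition_def
proof (intro conjI ballI)
  show "partition_on (carrier W) (cone_type_partition W S)"
    by (rule partition_on_cone)
  fix P assume P: "P \<in> cone_type_partition W S"
  then obtain x where x: "x \<in> P"
    using partition_on_cone by (metis partition_onD3 ex_in_conv)
  note x_car = cone_part(1)[OF P x] and P_eq = cone_part(2)[OF P x]
  show "\<exists>D. (\<forall>y \<in> P. left_descents W S y = D) \<and>
      (\<forall>s \<in> S - D. \<exists>P' \<in> cone_type_partition W S. s <# P \<subseteq> P')"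
  proof (intro exI conjI ballI)
    \<comment> \<open>This instantiates the witness \<open>D\<close> with the descent set of the
      chosen representative \<open>x\<close>.\<close>
    show desc: "left_descents W S y = left_descents W S x" if "y \<in> P" for y
      using that x_car by (auto simp: P_eq left_descents_eq_cone)
    fix s assume s: "s \<in> S - left_descents W S x"
    \<comment> \<open>\<open>s\<close> is a descent of neither \<open>x\<close> nor
      \<open>y\<close>, so both cone types are given by the same formula in the common cone type of
      \<open>x\<close> and \<open>y\<close>.\<close>
    have "cone_type W S (inv (s \<otimes> y)) = cone_type W S (inv (s \<otimes> x))" if "y \<in> P" for y
      using that s x_car desc[OF that] by (auto simp: P_eq cone_type_gen_mult)
    then have "s <# P \<subseteq>
        {y \<in> carrier W. cone_type W S (inv y) = cone_type W S (inv (s \<otimes> x))}"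
      using s by (auto simp: l_coset_def P_eq)
    then show "\<exists>P' \<in> cone_type_partition W S. s <# P \<subseteq> P'"
      using cone_partI[of "s \<otimes> x"] s x_car by auto
  qed
qed

section \<open>Minimality among regular partitions\<close>

text \<open>Induction on \<open>len z\<close>, stripping the first letter \<open>s\<close> of a
  reduced word of \<open>z\<close>. The part must vary, since \<open>s\<close> moves
  \<open>x\<close> and \<open>y\<close> together into another part. One inclusion suffices, as
  \<open>x\<close> and \<open>y\<close> are interchangeable.\<close>

lemma regular_part_cone_subset:
  assumes "regular_partition W S \<R>" "P \<in> \<R>" "x \<in> P" "y \<in> P"
  shows "z \<in> cone_type W S (inv x) \<Longrightarrow> z \<in> cone_type W S (inv y)"
  using assms(2-)
proof (induction "len z" arbitrary: z x y P)
  case (0 z x y P)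
  then have "y \<in> carrier W"
    using assms(1) by (auto simp: regular_partition_def partition_on_def)
  moreover have "z = \<one>"
    using 0 by (intro len_0_imp_one) (auto simp: cone_type_def)
  ultimately show ?case
    by (simp add: cone_type_def)
next
  case (Suc n z x y P)
  have car: "x \<in> carrier W" "y \<in> carrier W" "z \<in> carrier W"
    using Suc.prems assms(1)
    by (auto simp: regular_partition_def partition_on_def cone_type_def)
  obtain xs where xs: "xs \<in> lists S" "length xs = Suc n" "word_prod xs = z"
    using reduced_word[OF car(3)] Suc.hyps(2) by metis
  then obtain s ss where ss: "xs = s # ss" "s \<in> S" "ss \<in> lists S"
    by (cases xs) auto
  define z' where "z' = word_prod ss"
  have z': "z' \<in> carrier W" "z = s \<otimes> z'"
    using ss xs by (auto simp: z'_def)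
  \<comment> \<open>The word \<open>ss\<close> gives \<open>len z' \<le> n\<close>, which excludes
    the alternative \<open>n + 2\<close> left by \<open>len_gen_mult\<close>.\<close>
  have len_z': "len z' = n"
    using len_le[OF ss(3)] len_gen_mult[OF ss(2) z'(1)] xs(2) ss Suc.hyps(2) z'
    by (auto simp: z'_def)
  \<comment> \<open>If \<open>s\<close> shortened \<open>x\<close>, then
    \<open>inv x \<otimes> z\<close> would have length at most \<open>len x - 1 + n\<close>, short
    of the required \<open>len x + Suc n\<close>.\<close>
  have s_x: "s \<notin> left_descents W S x"
  proof -
    have "inv x \<otimes> z = inv (s \<otimes> x) \<otimes> z'"
      using car z' ss by (simp add: inv_mult_group gen_inv m_assoc)
    moreover have "len (inv (s \<otimes> x) \<otimes> z') \<le> len (s \<otimes> x) + n"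
      using len_mult_le[of "inv (s \<otimes> x)" z'] car z' ss len_z' by simp
    moreover have "len (inv x \<otimes> z) = len x + Suc n"
      using Suc.prems(1) Suc.hyps(2) car by (simp add: cone_type_def)
    ultimately show ?thesis
      using len_gen_mult[OF ss(2) car(1)] ss car by (auto simp: not_left_descent_iff)
  qed
  obtain D where D: "\<forall>x \<in> P. left_descents W S x = D"
      "\<forall>s \<in> S - D. \<exists>P' \<in> \<R>. s <# P \<subseteq> P'"
    using assms(1) Suc.prems(2) unfolding regular_partition_def by blast
  have s_y: "s \<notin> left_descents W S y" and "s \<in> S - D"
    using D(1) Suc.prems s_x ss(2) by auto
  then obtain P' where P': "P' \<in> \<R>" "s <# P \<subseteq> P'"
    using D(2) by blast
  have "s \<otimes> x \<in> P'" "s \<otimes> y \<in> P'"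
    using P'(2) Suc.prems by (auto simp: l_coset_def)
  \<comment> \<open>The criterion \<open>cone_type_gen_mult\<close> passes from \<open>z\<close> to
    \<open>z'\<close> at \<open>x\<close>; after the induction hypothesis it passes back at
    \<open>y\<close>.\<close>
  moreover have "z' \<in> cone_type W S (inv (s \<otimes> x))"
    using Suc.prems(1) Suc.hyps(2) car z' len_z' ss s_x by (simp add: cone_type_gen_mult)
  ultimately have "z' \<in> cone_type W S (inv (s \<otimes> y))"
    using Suc.hyps(1)[of z'] len_z' P'(1) by blast
  then show ?case
    using car z' ss s_y by (simp add: cone_type_gen_mult)
qed

text \<open>In the order where finer is larger, this makes the cone type partition a lower bound of
  all regular partitions.\<close>

lemma regular_refines_x:
  assumes "regular_partition W S \<R>"
  shows "refines (carrier W) \<R> (cone_type_partition W S)"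
  unfolding refines_def
proof (intro conjI ballI)
  show part: "partition_on (carrier W) \<R>"
    using assms by (simp add: regular_partition_def)
  show "partition_on (carrier W) (cone_type_partition W S)"
    by (rule partition_on_cone)
  fix P assume P: "P \<in> \<R>"
  then obtain x where x: "x \<in> P"
    using part by (metis partition_onD3 ex_in_conv)
  have sub: "P \<subseteq> carrier W"
    using part P by (auto simp: partition_on_def)
  have "P \<subseteq> {y \<in> carrier W. cone_type W S (inv y) = cone_type W S (inv x)}"
    using regular_part_cone_subset[OF assms P] x sub by blast
  then show "\<exists>Q \<in> cone_type_partition W S. P \<subseteq> Q"
    using cone_partI x sub by blast
qed

lemma cone_refines_descent: "refines (carrier W) (cone_type_partition W S) (descent_partition W S)"
  unfolding refines_def
proof (intro conjI ballI)
  show "partition_on (carrier W) (descent_partition W S)"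
    unfolding descent_partition_def using equiv_descent by (rule partition_on_quotient)
  show "partition_on (carrier W) (cone_type_partition W S)"
    by (rule partition_on_cone)
  fix P assume P: "P \<in> cone_type_partition W S"
  then obtain x where x: "x \<in> P"
    using partition_on_cone by (metis partition_onD3 ex_in_conv)
  have "P \<subseteq> {y \<in> carrier W. left_descents W S x = left_descents W S y}"
    using cone_part[OF P x] by (auto simp: left_descents_eq_cone)
  then show "\<exists>Q \<in> descent_partition W S. P \<subseteq> Q"
    using cone_part(1)[OF P x] by (auto simp: descent_partition_def quotient_def)
qed

text \<open>The cone type partition belongs to the family whose meet is taken and lies below all its
  members, so the meet is a minimum.\<close>

lemma cone_eq_completion:
  "cone_type_partition W S = regular_completion W S (descent_partition W S)"
proof -
  let ?L = "regular_partition_order W S" and ?T = "cone_type_partition W S"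
  let ?A = "{\<R> \<in> carrier ?L. partition_le (carrier W) (descent_partition W S) \<R>}"
  have T: "?T \<in> ?A"
    using regular_cone cone_refines_descent
    by (simp add: regular_partition_order_def partition_le_def)
  have "greatest ?L ?T (Lower ?L ?A)"
    using T regular_refines_x
    by (auto simp: greatest_def Lower_def regular_partition_order_def partition_le_def)
  \<comment> \<open>The meet is defined by \<open>SOME\<close>, so the greatest lower bound must be
    shown unique; antisymmetry of refinement gives this.\<close>
  moreover have "Q = ?T" if "greatest ?L Q (Lower ?L ?A)" for Q
  proof -
    from that T have "refines (carrier W) ?T Q" "refines (carrier W) Q ?T"
      using regular_refines_x
      by (auto simp: greatest_def Lower_def regular_partition_order_def partition_le_def)
    then show ?thesis
      by (metis refines_asym)
  qed
  ultimately show ?thesis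
    unfolding regular_completion_def inf_def by (metis (lifting) someI)
qed

end

theorem corollary4:
  fixes W :: "('a, 'b) monoid_scheme" and S :: "'a set"
  assumes "coxeter_system W S" and "finite S"
  shows "cone_type_partition W S = regular_completion W S (descent_partition W S)"
proof -
  interpret group W
    using assms(1) by (auto simp: coxeter_system_def presented_group_def)
  interpret coxeter W S
    by unfold_locales (rule assms(1))
  show ?thesis
    by (rule cone_eq_completion)
qed

end
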